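(* Let $f(x)=\max\{0,f_0-ax\}$ and $g(x)=g_0$ for $x\ge 0$, where $f_0,g_0\in(0,1]$, $a>0$, $c>0$ and $f_0g_0>c$. Every Nash equilibrium $\mathcal{C}(L_C^*,l_d^* )$ with $l_d^*=L_C^*$ and $$L_C^*<\frac{f_0}{a}-\frac{c}{a g_0}$$ is neither stable nor neutral-stable.
   Context: **Model.** $\mathcal{R}=[-L,L)$, $L>0$, with the torus metric $d(x,y)=\|x-y\|=\min\{|x-y|,2L-|x-y|\}$. The set of content-consuming agents is $\mathcal{A}_d=\mathcal{R}$ and the set of content-producing agents is $\mathcal{A}_s=\mathcal{R}$; agents are identified with points $y\in\mathcal R$. Put $p(x|y)=f(d(x,y))$ and $q(x|y)=g(d(x,y))$. Constants: $c>0$ (consumption cost), $0<E_p\le 1$, $E_q>0$. A community is a pair $C=(C_d,C_s)$ with $C_d\subseteq\mathcal{A}_d$, $C_s\subseteq\mathcal{A}_s$. With $\alpha_C(y)$ the fraction of content of $C$ consumed by $y\in C_d$ and $\beta_C(x|y)$ the rate at which $y\in C_s$ produces content on topic $x$ in $C$, the utilities are $$U_C^{(d)}(y)=\alpha_C(y)\int_{\mathcal{R}}[Q_C(x)p(x|y)-\beta_C(x)c]\,dx,\qquad U_C^{(s)}(y)=\int_{\mathcal{R}}\beta_C(x|y)[q(x|y)P_C(x)-\alpha_C c]\,dx,$$ where $Q_C(x)=\int_{C_s}\beta_C(x|y)q(x|y)dy$, $\beta_C(x)=\int_{C_s}\beta_C(x|y)dy$, $P_C(x)=\int_{C_d}\alpha_C(y)p(x|y)dy$,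 $\alpha_C=\int_{C_d}\alpha_C(z)dz$. A community structure is a set $\mathcal{C}$ of communities with allocations $\alpha_{\mathcal C}(y)=\{\alpha_C(y)\}_{C\in\mathcal{C}}$ and $\beta_{\mathcal C}(\cdot|y)=\{\beta_C(\cdot|y)\}_{C\in\mathcal{C}}$ satisfying $\sum_C\alpha_C(y)\le E_p$ and $\sum_C\int_{\mathcal R}\beta_C(x|y)dx\le E_q$. It is a Nash equilibrium if for every $y\in\mathcal{A}_d$ the allocation $\alpha_{\mathcal C}(y)$ maximizes $\sum_C U_C^{(d)}(y)$, and for every $y\in\mathcal{A}_s$ the allocation $\beta_{\mathcal C}(\cdot|y)$ maximizes $\sum_C U_C^{(s)}(y)$, under these constraints. **The family $\mathcal{C}(L_C,l_d)$.** Let $N\ge2$ be an integer, $L_C=L/N$, $0<l_d\le L_C$, and let $m_1,\dots,m_N$ be evenly spaced points in $\mathcal{R}$ with $m_{k+1}=m_1+2L_Ck$. The communities are $C_d^k=[m_k-l_d,m_k+l_d)$, $C_s^k=[m_k-L_C,m_k+L_C)$, $k=1,\dots,N$, with $\alpha_{C^k}(y)=E_p$ for $y\in C_d^k$ and $0$ otherwise, and $\beta_{C^k}(\cdot|y)=E_q\,\delta(x-x^*(y))$ (Dirac delta) for $y\in C^k_s$ and $0$ otherwise, where $x^*(y)=\arg\max_{x\in\mathcal{R}}q(x|y)P_{C^k}(x)$. It is known from earlier work that $\mathcal{C}(L_C^*,L_C^* )$ is a Nash equilibrium if and only if $L_C^*\le \frac{f_0}{a}-\frac{c}{ag_0}$.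 **Perturbation model.** Given a Nash equilibrium $\mathcal{C}(L_C^*,l_d^* )$, write $L_C=L_C^*$ and, by translation, consider two adjacent communities centered at $-L_C$ and $L_C$: $C^1_d=[-L_C-l_d^*,-L_C+l_d^* )$, $C^2_d=[L_C-l_d^*,L_C+l_d^* )$, $C^1_s=[-2L_C,0)$, $C^2_s=[0,2L_C)$. For $t\ge0$ the perturbed communities $C_1(t)=(C_d^1(t),C_s^1(t))$, $C_2(t)=(C_d^2(t),C_s^2(t))$ are $$C_d^1(t)=[-L_C-l_d^*,-L_C+l_d^*+\delta_{dl}(t)),\quad C_d^2(t)=[L_C-l_d^*+\delta_{dr}(t),L_C+l_d^* ),$$ $$C_s^1(t)=[-2L_C,\delta_{sl}(t)),\quad C_s^2(t)=[\delta_{sr}(t),2L_C).$$ Initial perturbations satisfy $\delta_{sl}(0)=\delta_{sr}(0)$, and $\delta_{dl}(0)=\delta_{dr}(0)$ if $l_d^*=L_C$, while $\delta_{dl}(0)<2L_C-2l_d^*+\delta_{dr}(0)$ if $l_d^*<L_C$. For $i=1,2$ let $x_i^*(y,t)=\arg\max_{x\in\mathcal{R}}q(x|y)\int_{C_d^i(t)}p(x|z)dz$; this is the midpoint of $C_d^i(t)$ (which is the chosen maximizer if it is not unique). The utilities are $$U_{C_i(t)}^{(d)}(y)=E_pE_q\int_{C_s^i(t)}[q(x_i^*(z,t)|z)p(x_i^*(z,t)|y)-c]dz,\quad U_{C_i(t)}^{(s)}(y)=E_pE_q\int_{C_d^i(t)}[q(x_i^*(y,t)|y)p(x_i^*(y,t)|z)-c]dz.$$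 The perturbations evolve for $t\ge 0$ by $$\tfrac{d\delta_{dl}}{dt}=U_{C_1(t)}^{(d)}(-L_C+l_d^*+\delta_{dl}(t))-\max\{0,U_{C_2(t)}^{(d)}(-L_C+l_d^*+\delta_{dl}(t))\},$$ $$\tfrac{d\delta_{dr}}{dt}=\max\{0,U_{C_1(t)}^{(d)}(L_C-l_d^*+\delta_{dr}(t))\}-U_{C_2(t)}^{(d)}(L_C-l_d^*+\delta_{dr}(t)),$$ $$\tfrac{d\delta_{sl}}{dt}=U_{C_1(t)}^{(s)}(-L_C+l_d^*+\delta_{sl}(t))-\max\{0,U_{C_2(t)}^{(s)}(-L_C+l_d^*+\delta_{sl}(t))\},$$ $$\tfrac{d\delta_{sr}}{dt}=\max\{0,U_{C_1(t)}^{(s)}(L_C-l_d^*+\delta_{sr}(t))\}-U_{C_2(t)}^{(s)}(L_C-l_d^*+\delta_{sr}(t)).$$ **Stable.** $\mathcal{C}(L_C^*,l_d^* )$ is stable if there is $\delta>0$ such that whenever $0<\delta_{dl}(0),\delta_{dr}(0),\delta_{sl}(0),\delta_{sr}(0)\le\delta$ (initial perturbations as in the model), one has $0\le\delta_{dl}(t),\delta_{dr}(t),\delta_{sl}(t),\delta_{sr}(t)\le\delta$ for all $t\ge0$ and all four functions tend to $0$ as $t\to\infty$. **Neutral-stable.** $\mathcal{C}(L_C^*,l_d^* )$ is neutral-stable if at least one of the following holds. (1) There is $\delta>0$ such that whenever $0<\delta_{dl}(0),\delta_{dr}(0),\delta_{sl}(0),\delta_{sr}(0)\le\delta$, one has $0\le\delta_{dl}(t),\delta_{dr}(t)\le\delta$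 for $t\ge0$, $\lim_{t\to\infty}\delta_{dl}(t)=\lim_{t\to\infty}\delta_{dr}(t)=0$, and $\lim_{t\to\infty}U_{C_1(t)}^{(s)}(y)=\lim_{t\to\infty}U_{C_2(t)}^{(s)}(y)>0$ for all $y\in C_s^1\cup C_s^2$. (2) There is $\delta>0$ such that whenever $0<\delta_{dl}(0),\delta_{dr}(0),\delta_{sl}(0),\delta_{sr}(0)\le\delta$, one has $0\le\delta_{sl}(t),\delta_{sr}(t)\le\delta$ for $t\ge0$, $\lim_{t\to\infty}\delta_{sl}(t)=\lim_{t\to\infty}\delta_{sr}(t)=0$, and $\lim_{t\to\infty}U_{C_1(t)}^{(d)}(y)=\lim_{t\to\infty}U_{C_2(t)}^{(d)}(y)>0$ for all $y\in C_d^1\cup C_d^2$. *)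

theory Defs
  imports "HOL-Probability.Giry_Monad"
begin

text \<open>
  Parameters: the torus is \<open>[-L, L)\<close>, \<open>c\<close> is the consumption cost, \<open>Ep\<close> and \<open>Eq\<close> are the
  consumption and production budgets, and \<open>p(x|y) = f(d(x,y))\<close>, \<open>q(x|y) = g(d(x,y))\<close>.
\<close>

type_synonym community = "real set \<times> real set"

locale community_model =
  fixes L c Ep Eq :: real and f g :: "real \<Rightarrow> real"
begin

definition R :: "real set" where
  "R = {-L..<L}"

definition d :: "real \<Rightarrow> real \<Rightarrow> real" where
  "d x y = min \<bar>x - y\<bar> (2 * L - \<bar>x - y\<bar>)"

definition p :: "real \<Rightarrow> real \<Rightarrow> real" where
  "p x y = f (d x y)"

definition q :: "real \<Rightarrow> real \<Rightarrow> real" where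
  "q x y = g (d x y)"

text \<open>
  Production allocations contain Dirac deltas, so \<open>\<beta>\<^sub>C(\<cdot>|y)\<close> is a Borel measure concentrated on
  \<open>R\<close> rather than a density. Accordingly \<open>\<beta>\<^sub>C(x) dx\<close> and \<open>Q\<^sub>C(x) dx\<close> are the measures below.
  In the following definitions \<open>\<alpha>\<close> and \<open>\<beta>\<close> are the allocations in the single community \<open>C\<close>.
\<close>

definition production :: "community \<Rightarrow> (real \<Rightarrow> real measure) \<Rightarrow> real measure" where
  "production C \<beta> =
     measure_of UNIV (sets borel) (\<lambda>A. \<integral>\<^sup>+ y \<in> snd C. emeasure (\<beta> y) A \<partial>lborel)"

definition Q :: "community \<Rightarrow> (real \<Rightarrow> real measure) \<Rightarrow> real measure" where
  "Q C \<beta> =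
     measure_of UNIV (sets borel)
       (\<lambda>A. \<integral>\<^sup>+ y \<in> snd C. (\<integral>\<^sup>+ x \<in> A. ennreal (q x y) \<partial>\<beta> y) \<partial>lborel)"

definition P :: "community \<Rightarrow> (real \<Rightarrow> real) \<Rightarrow> real \<Rightarrow> real" where
  "P C \<alpha> x = (LINT y:fst C|lborel. \<alpha> y * p x y)"

definition consumption :: "community \<Rightarrow> (real \<Rightarrow> real) \<Rightarrow> real" where
  "consumption C \<alpha> = (LINT z:fst C|lborel. \<alpha> z)"

text \<open>
  The last argument is the agent's own allocation in \<open>C\<close>. A single agent is a Lebesgue null set, so
  it does not influence the aggregates \<open>Q\<close>, \<open>production\<close>, \<open>P\<close> and \<open>consumption\<close>.
\<close>

definition Ud :: "community \<Rightarrow> (real \<Rightarrow> real measure) \<Rightarrow> real \<Rightarrow> real \<Rightarrow> real" where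
  "Ud C \<beta> y a = a * ((LINT x:R|Q C \<beta>. p x y) - c * measure (production C \<beta>) R)"

definition Us :: "community \<Rightarrow> (real \<Rightarrow> real) \<Rightarrow> real \<Rightarrow> real measure \<Rightarrow> real" where
  "Us C \<alpha> y b = (LINT x:R|b. q x y * P C \<alpha> x - consumption C \<alpha> * c)"

definition feasible_consumption :: "community set \<Rightarrow> (community \<Rightarrow> real) \<Rightarrow> bool" where
  "feasible_consumption CC a \<longleftrightarrow> (\<forall>C\<in>CC. 0 \<le> a C) \<and> (\<Sum>C\<in>CC. a C) \<le> Ep"

definition feasible_production :: "community set \<Rightarrow> (community \<Rightarrow> real measure) \<Rightarrow> bool" where
  "feasible_production CC b \<longleftrightarrow>
     (\<forall>C\<in>CC. sets (b C) = sets borel \<and> emeasure (b C) (- R) = 0) \<and>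
     (\<Sum>C\<in>CC. emeasure (b C) R) \<le> ennreal Eq"

definition community_structure ::
  "community set \<Rightarrow> (community \<Rightarrow> real \<Rightarrow> real) \<Rightarrow> (community \<Rightarrow> real \<Rightarrow> real measure) \<Rightarrow> bool" where
  "community_structure CC \<alpha> \<beta> \<longleftrightarrow>
     finite CC \<and> (\<forall>C\<in>CC. fst C \<subseteq> R \<and> snd C \<subseteq> R) \<and>
     (\<forall>y\<in>R. feasible_consumption CC (\<lambda>C. \<alpha> C y) \<and> feasible_production CC (\<lambda>C. \<beta> C y)) \<and>
     (\<forall>C\<in>CC. (\<forall>y\<in>R - fst C. \<alpha> C y = 0) \<and> (\<forall>y\<in>R - snd C. emeasure (\<beta> C y) R = 0))"

text \<open>
  A deviating agent may reallocate to any community of the structure, not only to those it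
  currently belongs to.
\<close>

definition nash_equilibrium ::
  "community set \<Rightarrow> (community \<Rightarrow> real \<Rightarrow> real) \<Rightarrow> (community \<Rightarrow> real \<Rightarrow> real measure) \<Rightarrow> bool" where
  "nash_equilibrium CC \<alpha> \<beta> \<longleftrightarrow>
     community_structure CC \<alpha> \<beta> \<and>
     (\<forall>y\<in>R. \<forall>a. feasible_consumption CC a \<longrightarrow>
        (\<Sum>C\<in>CC. Ud C (\<beta> C) y (a C)) \<le> (\<Sum>C\<in>CC. Ud C (\<beta> C) y (\<alpha> C y))) \<and>
     (\<forall>y\<in>R. \<forall>b. feasible_production CC b \<longrightarrow>
        (\<Sum>C\<in>CC. Us C (\<alpha> C) y (b C)) \<le> (\<Sum>C\<in>CC. Us C (\<alpha> C) y (\<beta> C y)))"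


subsection \<open>The family of interval community structures\<close>

text \<open>The interval \<open>[u, v)\<close> read modulo \<open>2 L\<close>, since the intervals around the centers may wrap.\<close>

definition arc :: "real \<Rightarrow> real \<Rightarrow> real set" where
  "arc u v = {y \<in> R. \<exists>j::int. u \<le> y + 2 * L * of_int j \<and> y + 2 * L * of_int j < v}"

text \<open>The \<open>N\<close> centers are \<open>center m1 LC k\<close> for \<open>k < N\<close>.\<close>

definition center :: "real \<Rightarrow> real \<Rightarrow> nat \<Rightarrow> real" where
  "center m1 LC k = m1 + 2 * LC * real k"

definition family :: "nat \<Rightarrow> real \<Rightarrow> real \<Rightarrow> real \<Rightarrow> community set" where
  "family N m1 LC ld =
     (\<lambda>k. (arc (center m1 LC k - ld) (center m1 LC k + ld),
           arc (center m1 LC k - LC) (center m1 LC k + LC))) ` {..<N}"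

definition family_alpha :: "community \<Rightarrow> real \<Rightarrow> real" where
  "family_alpha C y = (if y \<in> fst C then Ep else 0)"

definition family_topic :: "community \<Rightarrow> real \<Rightarrow> real" where
  "family_topic C y = arg_max (\<lambda>x. q x y * P C (family_alpha C) x) (\<lambda>x. x \<in> R)"

definition family_beta :: "community \<Rightarrow> real \<Rightarrow> real measure" where
  "family_beta C y =
     (if y \<in> snd C then scale_measure (ennreal Eq) (return borel (family_topic C y))
      else null_measure borel)"


subsection \<open>The perturbation model\<close>

text \<open>
  The topic chosen by producer \<open>y\<close> when the consumers are \<open>[u, v)\<close>: a maximizer, and the midpoint of
  \<open>u\<close> and \<open>v\<close> whenever that is one (this also fixes the choice for the empty interval).
\<close>

definition topic :: "real \<Rightarrow> real \<Rightarrow> real \<Rightarrow> real" where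
  "topic u v y =
     (let F = (\<lambda>x. q x y * (LINT z:{u..<v}|lborel. p x z)) in
      if is_arg_max F (\<lambda>x. x \<in> R) (midpoint u v) then midpoint u v
      else arg_max F (\<lambda>x. x \<in> R))"

text \<open>Utilities in a community with consumers \<open>[u, v)\<close> and producers \<open>[u', v')\<close>.\<close>

definition pert_Ud :: "real \<Rightarrow> real \<Rightarrow> real \<Rightarrow> real \<Rightarrow> real \<Rightarrow> real" where
  "pert_Ud u v u' v' y =
     Ep * Eq * (LINT z:{u'..<v'}|lborel. q (topic u v z) z * p (topic u v z) y - c)"

definition pert_Us :: "real \<Rightarrow> real \<Rightarrow> real \<Rightarrow> real" where
  "pert_Us u v y =
     Ep * Eq * (LINT z:{u..<v}|lborel. q (topic u v y) y * p (topic u v y) z - c)"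

text \<open>The utilities of the two perturbed communities, for given values of the perturbations.\<close>

definition Ud1 :: "real \<Rightarrow> real \<Rightarrow> real \<Rightarrow> real \<Rightarrow> real \<Rightarrow> real" where
  "Ud1 LC ld dl sl y = pert_Ud (- LC - ld) (- LC + ld + dl) (- 2 * LC) sl y"

definition Ud2 :: "real \<Rightarrow> real \<Rightarrow> real \<Rightarrow> real \<Rightarrow> real \<Rightarrow> real" where
  "Ud2 LC ld dr sr y = pert_Ud (LC - ld + dr) (LC + ld) sr (2 * LC) y"

definition Us1 :: "real \<Rightarrow> real \<Rightarrow> real \<Rightarrow> real \<Rightarrow> real" where
  "Us1 LC ld dl y = pert_Us (- LC - ld) (- LC + ld + dl) y"

definition Us2 :: "real \<Rightarrow> real \<Rightarrow> real \<Rightarrow> real \<Rightarrow> real" where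
  "Us2 LC ld dr y = pert_Us (LC - ld + dr) (LC + ld) y"

text \<open>
  The perturbed communities are communities of the model, and the agents whose utilities drive
  the evolution are agents of the model (elements of \<open>R\<close>).
\<close>

definition in_model :: "real \<Rightarrow> real \<Rightarrow> real \<Rightarrow> real \<Rightarrow> real \<Rightarrow> real \<Rightarrow> bool" where
  "in_model LC ld dl dr sl sr \<longleftrightarrow>
     {- LC - ld..<- LC + ld + dl} \<subseteq> R \<and> {LC - ld + dr..<LC + ld} \<subseteq> R \<and>
     {- 2 * LC..<sl} \<subseteq> R \<and> {sr..<2 * LC} \<subseteq> R \<and>
     - LC + ld + dl \<in> R \<and> LC - ld + dr \<in> R \<and> - LC + ld + sl \<in> R \<and> LC - ld + sr \<in> R"

definition evolution ::
  "real \<Rightarrow> real \<Rightarrow> (real \<Rightarrow> real) \<Rightarrow> (real \<Rightarrow> real) \<Rightarrow> (real \<Rightarrow> real) \<Rightarrow> (real \<Rightarrow> real) \<Rightarrow> bool" where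
  "evolution LC ld dl dr sl sr \<longleftrightarrow>
     (\<forall>t\<ge>0. in_model LC ld (dl t) (dr t) (sl t) (sr t) \<and>
       (dl has_real_derivative
          Ud1 LC ld (dl t) (sl t) (- LC + ld + dl t)
          - max 0 (Ud2 LC ld (dr t) (sr t) (- LC + ld + dl t))) (at t within {0..}) \<and>
       (dr has_real_derivative
          max 0 (Ud1 LC ld (dl t) (sl t) (LC - ld + dr t))
          - Ud2 LC ld (dr t) (sr t) (LC - ld + dr t)) (at t within {0..}) \<and>
       (sl has_real_derivative
          Us1 LC ld (dl t) (- LC + ld + sl t)
          - max 0 (Us2 LC ld (dr t) (- LC + ld + sl t))) (at t within {0..}) \<and>
       (sr has_real_derivative
          max 0 (Us1 LC ld (dl t) (LC - ld + sr t))
          - Us2 LC ld (dr t) (LC - ld + sr t)) (at t within {0..}))"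

definition initial_perturbation :: "real \<Rightarrow> real \<Rightarrow> real \<Rightarrow> real \<Rightarrow> real \<Rightarrow> real \<Rightarrow> bool" where
  "initial_perturbation LC ld dl0 dr0 sl0 sr0 \<longleftrightarrow>
     sl0 = sr0 \<and> (ld = LC \<longrightarrow> dl0 = dr0) \<and> (ld < LC \<longrightarrow> dl0 < 2 * LC - 2 * ld + dr0)"

text \<open>
  \<open>Phi\<close> holds for the evolution from every initial perturbation of size at most \<open>\<delta>\<close>, for some
  \<open>\<delta> > 0\<close>. A statement about \<open>\<delta>\<^sub>d\<^sub>l(t), \<dots>\<close> for all \<open>t \<ge> 0\<close> presupposes that the evolution exists for
  all \<open>t \<ge> 0\<close>; without the existence clause it would be vacuously true for perturbations that grow
  until they leave the model.
\<close>

definition for_small_perturbations ::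
  "real \<Rightarrow> real \<Rightarrow>
   (real \<Rightarrow> (real \<Rightarrow> real) \<Rightarrow> (real \<Rightarrow> real) \<Rightarrow> (real \<Rightarrow> real) \<Rightarrow> (real \<Rightarrow> real) \<Rightarrow> bool) \<Rightarrow> bool" where
  "for_small_perturbations LC ld Phi \<longleftrightarrow>
     (\<exists>\<delta>>0. \<forall>dl0\<in>{0<..\<delta>}. \<forall>dr0\<in>{0<..\<delta>}. \<forall>sl0\<in>{0<..\<delta>}. \<forall>sr0\<in>{0<..\<delta>}.
        initial_perturbation LC ld dl0 dr0 sl0 sr0 \<longrightarrow>
        (\<exists>dl dr sl sr. evolution LC ld dl dr sl sr \<and>
            dl 0 = dl0 \<and> dr 0 = dr0 \<and> sl 0 = sl0 \<and> sr 0 = sr0) \<and>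
        (\<forall>dl dr sl sr. evolution LC ld dl dr sl sr \<and>
            dl 0 = dl0 \<and> dr 0 = dr0 \<and> sl 0 = sl0 \<and> sr 0 = sr0 \<longrightarrow> Phi \<delta> dl dr sl sr))"

definition stable :: "real \<Rightarrow> real \<Rightarrow> bool" where
  "stable LC ld \<longleftrightarrow>
     for_small_perturbations LC ld (\<lambda>\<delta> dl dr sl sr.
       (\<forall>t\<ge>0. dl t \<in> {0..\<delta>} \<and> dr t \<in> {0..\<delta>} \<and> sl t \<in> {0..\<delta>} \<and> sr t \<in> {0..\<delta>}) \<and>
       (dl \<longlongrightarrow> 0) at_top \<and> (dr \<longlongrightarrow> 0) at_top \<and> (sl \<longlongrightarrow> 0) at_top \<and> (sr \<longlongrightarrow> 0) at_top)"

definition neutral_stable :: "real \<Rightarrow> real \<Rightarrow> bool" where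
  "neutral_stable LC ld \<longleftrightarrow>
     for_small_perturbations LC ld (\<lambda>\<delta> dl dr sl sr.
       (\<forall>t\<ge>0. dl t \<in> {0..\<delta>} \<and> dr t \<in> {0..\<delta>}) \<and>
       (dl \<longlongrightarrow> 0) at_top \<and> (dr \<longlongrightarrow> 0) at_top \<and>
       (\<forall>y \<in> {- 2 * LC..<0} \<union> {0..<2 * LC}. \<exists>l>0.
          ((\<lambda>t. Us1 LC ld (dl t) y) \<longlongrightarrow> l) at_top \<and>
          ((\<lambda>t. Us2 LC ld (dr t) y) \<longlongrightarrow> l) at_top)) \<or>
     for_small_perturbations LC ld (\<lambda>\<delta> dl dr sl sr.
       (\<forall>t\<ge>0. sl t \<in> {0..\<delta>} \<and> sr t \<in> {0..\<delta>}) \<and>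
       (sl \<longlongrightarrow> 0) at_top \<and> (sr \<longlongrightarrow> 0) at_top \<and>
       (\<forall>y \<in> {- LC - ld..<- LC + ld} \<union> {LC - ld..<LC + ld}. \<exists>l>0.
          ((\<lambda>t. Ud1 LC ld (dl t) (sl t) y) \<longlongrightarrow> l) at_top \<and>
          ((\<lambda>t. Ud2 LC ld (dr t) (sr t) y) \<longlongrightarrow> l) at_top))"

end

end

theory Submission
  imports Defs
begin

text \<open>
  The rest point is a saddle, and this can be seen along the diagonal. If both consumer boundaries
  are displaced by \<open>e\<close> and both producer boundaries by \<open>s\<close>, then every agent chooses the midpoint
  of the consumers as topic, and with \<open>\<kappa> = g0 (f0 - a LC) - c > 0\<close> the evolution is, near the rest
  point and up to the factor \<open>Ep Eq\<close>,
  \<open>e' = 2 \<kappa> s - 2 LC g0 a e\<close> and \<open>s' = 2 \<kappa> e\<close>.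
  So a displacement of the consumers makes the producers follow, and they never come back; a
  displacement of the producers in turn keeps attracting the consumers.

  Linearization alone would not suffice: the bound \<open>\<delta>\<close> in the two notions of stability may be
  large, so a solution could leave the neighbourhood of the rest point along the unstable
  direction and return to it from another side. The argument is therefore global in time. Write
  \<open>profit r\<close> for the net value of content at distance \<open>r\<close>, and \<open>break_even\<close> for the distance at
  which it vanishes; the hypothesis says \<open>LC < break_even\<close>. For initial perturbations that are all
  equal to \<open>e \<le> min (2 (break_even - LC)) (2 LC)\<close>, the following persists for all times
  (\<open>symmetric_evolution\<close>):

  \<^item> \<open>LC + dl / 2 \<le> break_even\<close>, because a boundary consumer beyond this point is farther than
    \<open>break_even\<close> from the topic of the left community (\<open>boundary_consumer_le\<close>);

  \<^item> \<open>dl = dr\<close>, because the velocities of the two boundaries are values of the same Lipschitz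
    function at \<open>dl\<close> and at \<open>dr\<close> (\<open>boundaries_coincide\<close>);

  \<^item> \<open>sl\<close> and \<open>sr\<close> are nondecreasing, because the left community has more consumers within
    the break-even distance of its topic than the right one (\<open>producers_nondecreasing\<close>);

  \<^item> \<open>dl > 0\<close>, because at \<open>dl = 0\<close> the larger supply of content in the left community pulls the
    boundary consumer to the left community (\<open>boundary_consumer_drift\<close>).

  Hence \<open>sl \<ge> e\<close> forever, which excludes stability and the second form of neutral stability.
  By the lower bound on the drift \<open>dl\<close> cannot tend to \<open>0\<close> either, which excludes the
  first form.
\<close>

section \<open>Differential inequalities on the half line\<close>

lemma has_real_derivative_at_of_within:
  fixes x :: "real \<Rightarrow> real"
  assumes "(x has_real_derivative D) (at t within {0..})" and "0 < t"
  shows "(x has_real_derivative D) (at t)"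
proof -
  have "at t within {0..} = at t"
    using assms(2) by (intro at_within_interior) simp
  then show ?thesis using assms(1) by simp
qed

lemma continuous_on_trajectory:
  fixes x :: "real \<Rightarrow> real"
  assumes "\<And>t. 0 \<le> t \<Longrightarrow> (x has_real_derivative D t) (at t within {0..})"
  shows "continuous_on {0..} x"
  unfolding continuous_on_eq_continuous_within
  using assms by (blast intro: DERIV_continuous)

lemma nondecreasing_on_trajectory:
  fixes x :: "real \<Rightarrow> real"
  assumes der: "\<And>t. 0 \<le> t \<Longrightarrow> (x has_real_derivative D t) (at t within {0..})"
    and "0 \<le> a" and "a \<le> b" and nn: "\<And>t. a < t \<Longrightarrow> t < b \<Longrightarrow> 0 \<le> D t"
  shows "x a \<le> x b"
proof (rule DERIV_nonneg_imp_increasing_open[OF \<open>a \<le> b\<close>])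
  show "\<exists>y. (x has_real_derivative y) (at t) \<and> 0 \<le> y" if "a < t" "t < b" for t
    using has_real_derivative_at_of_within[OF der[of t]] nn[OF that] that \<open>0 \<le> a\<close>
    by (intro exI[of _ "D t"]) auto
  show "continuous_on {a..b} x"
  proof (rule continuous_on_subset)
    show "continuous_on {0..} x" by (rule continuous_on_trajectory[OF der])
  qed (use \<open>0 \<le> a\<close> in auto)
qed

text \<open>
  The case of Gronwall's inequality that gives uniqueness: \<open>w\<^sup>2 exp (- 2 M t)\<close> is nonincreasing.
\<close>

lemma gronwall_zero:
  fixes w :: "real \<Rightarrow> real"
  assumes der: "\<And>t. 0 \<le> t \<Longrightarrow> (w has_real_derivative D t) (at t within {0..})"
    and bound: "\<And>t. 0 < t \<Longrightarrow> t < T \<Longrightarrow> \<bar>D t\<bar> \<le> M * \<bar>w t\<bar>"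
    and "w 0 = 0" and "0 \<le> t" and "t \<le> T"
  shows "w t = 0"
proof -
  define x where "x = (\<lambda>t. - ((w t)\<^sup>2 * exp (- (2 * M * t))))"
  define D' where "D' = (\<lambda>t. - (2 * w t * D t - 2 * M * (w t)\<^sup>2) * exp (- (2 * M * t)))"
  have "x 0 \<le> x t"
  proof (rule nondecreasing_on_trajectory[where x = x and D = D' and a = 0 and b = t])
    show "(x has_real_derivative D' s) (at s within {0..})" if "0 \<le> s" for s
      unfolding x_def D'_def
      by (rule derivative_eq_intros der that refl | simp add: algebra_simps power2_eq_square)+
    show "0 \<le> D' s" if "0 < s" "s < t" for s
    proof -
      have "w s * D s \<le> \<bar>w s\<bar> * \<bar>D s\<bar>" by (metis abs_ge_self abs_mult)
      also have "\<dots> \<le> \<bar>w s\<bar> * (M * \<bar>w s\<bar>)"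
        using bound[of s] that \<open>t \<le> T\<close> by (intro mult_left_mono) auto
      also have "\<dots> = M * (w s)\<^sup>2" by (simp add: power2_eq_square)
      finally show ?thesis unfolding D'_def by (intro mult_nonneg_nonneg) auto
    qed
  qed (use assms in auto)
  then have "(w t)\<^sup>2 * exp (- (2 * M * t)) \<le> 0"
    using \<open>w 0 = 0\<close> by (simp add: x_def)
  then have "(w t)\<^sup>2 \<le> 0"
    by (simp add: mult_le_0_iff)
  then show ?thesis by simp
qed

text \<open>
  Consider the last time before \<open>t\<close> at which \<open>x \<le> b\<close>; from then on \<open>x\<close> does not increase. The
  velocity may vanish on the barrier, so a sign at the time of crossing would not be enough.
\<close>

lemma upper_barrier:
  fixes x :: "real \<Rightarrow> real"
  assumes der: "\<And>t. 0 \<le> t \<Longrightarrow> (x has_real_derivative D t) (at t within {0..})"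
    and barrier: "\<And>t. 0 < t \<Longrightarrow> b < x t \<Longrightarrow> D t \<le> 0"
    and "x 0 \<le> b" and "0 \<le> t"
  shows "x t \<le> b"
proof (rule ccontr)
  assume "\<not> x t \<le> b"
  have cont: "continuous_on {0..} x" by (rule continuous_on_trajectory[OF der])
  let ?S = "{s \<in> {0..t}. x s \<le> b}"
  have "compact ?S"
    using continuous_on_subset[OF cont, of "{0..t}"] continuous_on_closed_Collect_le[of "{0..t}" x "\<lambda>_. b"]
    by (auto simp: compact_eq_bounded_closed intro: bounded_subset[of "{0..t}"])
  moreover have "0 \<in> ?S" using assms by simp
  ultimately obtain r where r: "r \<in> ?S" "\<And>s. s \<in> ?S \<Longrightarrow> s \<le> r"
    using compact_attains_sup[of ?S] by blast
  have "- x r \<le> - x t"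
  proof (rule nondecreasing_on_trajectory[where x = "\<lambda>s. - x s" and D = "\<lambda>s. - D s" and a = r and b = t])
    show "((\<lambda>s. - x s) has_real_derivative - D s) (at s within {0..})" if "0 \<le> s" for s
      using DERIV_minus[OF der[OF that]] .
    show "0 \<le> - D s" if "r < s" "s < t" for s
      using barrier[of s] r(1) r(2)[of s] that by fastforce
  qed (use r in auto)
  then show False using r \<open>\<not> x t \<le> b\<close> by simp
qed

text \<open>
  The form in which an open region is shown never to be left: the functions that define the region
  are combined into the minimum \<open>m\<close>, and at a first exit time \<open>m\<close> would vanish.
\<close>

lemma positive_by_continuation:
  fixes m :: "real \<Rightarrow> real"
  assumes cont: "continuous_on {0..} m" and "0 < m 0"
    and step: "\<And>T. 0 < T \<Longrightarrow> (\<And>s. 0 \<le> s \<Longrightarrow> s < T \<Longrightarrow> 0 < m s) \<Longrightarrow> m T \<noteq> 0"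
    and "0 \<le> t"
  shows "0 < m t"
proof (rule ccontr)
  assume "\<not> 0 < m t"
  let ?S = "{s \<in> {0..t}. m s = 0}"
  have cont_t: "continuous_on {0..t} m"
    using continuous_on_subset[OF cont, of "{0..t}"] by auto
  then have "compact ?S"
    using continuous_closed_preimage_constant[of "{0..t}" m 0]
    by (auto simp: compact_eq_bounded_closed intro: bounded_subset[of "{0..t}"])
  moreover have "?S \<noteq> {}"
  proof -
    have "m t \<le> 0" and "0 \<le> m 0" using \<open>\<not> 0 < m t\<close> \<open>0 < m 0\<close> by auto
    from IVT2'[OF this \<open>0 \<le> t\<close> cont_t] show ?thesis by auto
  qed
  ultimately obtain T where T: "T \<in> ?S" "\<And>s. s \<in> ?S \<Longrightarrow> T \<le> s"
    using compact_attains_inf[of ?S] by blast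
  have "0 < m s" if "0 \<le> s" "s < T" for s
  proof (rule ccontr)
    assume "\<not> 0 < m s"
    then have "m s \<le> 0" and "0 \<le> m 0" using \<open>0 < m 0\<close> by simp_all
    moreover have "continuous_on {0..s} m"
      by (rule continuous_on_subset[OF cont]) simp
    ultimately have "\<exists>r. 0 \<le> r \<and> r \<le> s \<and> m r = 0"
      using \<open>0 \<le> s\<close> by (intro IVT2')
    then obtain r where "0 \<le> r" "r \<le> s" "m r = 0" by (elim exE conjE)
    with T(1) \<open>s < T\<close> have "T \<le> r" by (intro T(2)) auto
    then show False using \<open>r \<le> s\<close> \<open>s < T\<close> by simp
  qed
  moreover have "0 < T"
    using T(1) \<open>0 < m 0\<close> by (cases "T = 0") (simp_all add: order_less_le)
  ultimately have "m T \<noteq> 0" by (rule step[rotated])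
  then show False using T(1) by simp
qed

section \<open>The midpoint of the consumers is an optimal topic\<close>

lemma continuous_antiderivative:
  fixes \<psi> :: "real \<Rightarrow> real"
  assumes "continuous_on UNIV \<psi>"
  obtains \<Psi> where "\<And>x. (\<Psi> has_real_derivative \<psi> x) (at x)"
proof -
  have "\<exists>F. \<forall>x::real. -\<infinity> < ereal x \<longrightarrow> ereal x < \<infinity> \<longrightarrow> (F has_vector_derivative \<psi> x) (at x)"
    using assms by (intro einterval_antiderivative) (auto simp: continuous_on_eq_continuous_at)
  then show ?thesis
    using that by (auto simp: has_real_derivative_iff_has_vector_derivative)
qed

lemma set_integral_reflected_antiderivative:
  fixes \<psi> \<Psi> :: "real \<Rightarrow> real"
  assumes cont: "continuous_on UNIV \<psi>" and der: "\<And>x. (\<Psi> has_real_derivative \<psi> x) (at x)"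
    and "u \<le> v"
  shows "(LINT z:{u..<v}|lborel. \<psi> (x - z)) = \<Psi> (x - u) - \<Psi> (x - v)"
proof -
  have "(LINT z:{u..<v}|lborel. \<psi> (x - z)) = (LBINT z=u..v. \<psi> (x - z))"
    using \<open>u \<le> v\<close> by (simp add: interval_integral_Ico)
  also have "\<dots> = (- \<Psi> (x - v)) - (- \<Psi> (x - u))"
  proof (rule interval_integral_FTC_finite)
    show "continuous_on {min u v..max u v} (\<lambda>z. \<psi> (x - z))"
      by (intro continuous_on_compose2[OF cont] continuous_intros) auto
    have "((\<lambda>z. - \<Psi> (x - z)) has_real_derivative \<psi> (x - z)) (at z within S)" for z S
      by (rule derivative_eq_intros DERIV_chain2[OF der] refl | simp)+
    then show "((\<lambda>z. - \<Psi> (x - z)) has_vector_derivative \<psi> (x - z)) (at z within {min u v..max u v})"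
      for z by (simp add: has_real_derivative_iff_has_vector_derivative)
  qed
  finally show ?thesis by simp
qed

context community_model
begin

text \<open>
  The window \<open>[u, v)\<close> of half-length \<open>h\<close>, seen from a point at offset \<open>s\<close> from its midpoint,
  collects \<open>K s = \<Psi> (s + h) - \<Psi> (s - h)\<close>, where \<open>\<Psi>\<close> is an antiderivative of the profile \<open>\<psi>\<close>.
  Moving away from the midpoint trades weight at the near end of the window for weight at the far
  end, and for \<open>\<bar>s\<bar> \<le> L\<close> the far end is also the farther one on the torus, so \<open>K\<close> decreases.
  Larger offsets reduce to this case by the period \<open>2 L\<close>.
\<close>

lemma p_integral_le_midpoint:
  assumes cont: "continuous_on UNIV f" and mono: "antimono f"
    and "u \<le> v" and "u \<in> {-L..L}" and "v \<in> {-L..L}" and "x \<in> {-L..L}"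
  shows "(LINT z:{u..<v}|lborel. p x z) \<le> (LINT z:{u..<v}|lborel. p (midpoint u v) z)"
proof -
  define \<psi> where "\<psi> = (\<lambda>w. f (min \<bar>w\<bar> (2 * L - \<bar>w\<bar>)))"
  have cont\<psi>: "continuous_on UNIV \<psi>"
    unfolding \<psi>_def by (intro continuous_on_compose2[OF cont] continuous_intros) auto
  obtain \<Psi> where der: "\<And>w. (\<Psi> has_real_derivative \<psi> w) (at w)"
    using continuous_antiderivative[OF cont\<psi>] by blast
  have der_shift: "((\<lambda>s. \<Psi> (s + b)) has_real_derivative \<psi> (s + b)) (at s within S)" for b s S
    using der[of "s + b"] by (simp add: DERIV_shift has_field_derivative_at_within)
  define h where "h = (v - u) / 2"
  have h: "0 \<le> h" "h \<le> L" using assms by (auto simp: h_def)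
  define K where "K = (\<lambda>s. \<Psi> (s + h) - \<Psi> (s - h))"
  have derK: "(K has_real_derivative \<psi> (s + h) - \<psi> (s - h)) (at s)" for s
    unfolding K_def using DERIV_diff[OF der_shift[of h] der_shift[of "- h"]] by simp
  have integral: "(LINT z:{u..<v}|lborel. p y z) = K (y - midpoint u v)" for y
  proof -
    have "(LINT z:{u..<v}|lborel. p y z) = (LINT z:{u..<v}|lborel. \<psi> (y - z))"
      by (simp add: p_def d_def \<psi>_def)
    also have "\<dots> = \<Psi> (y - u) - \<Psi> (y - v)"
      by (rule set_integral_reflected_antiderivative[OF cont\<psi> der \<open>u \<le> v\<close>])
    also have "\<dots> = K (y - midpoint u v)"
    proof -
      have "y - midpoint u v + h = y - u" and "y - midpoint u v - h = y - v"
        by (simp_all add: h_def midpoint_def field_simps)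
      then show ?thesis by (simp only: K_def)
    qed
    finally show ?thesis .
  qed
  have near: "K s \<le> K 0" if "\<bar>s\<bar> \<le> L" for s
  proof (cases "0 \<le> s")
    case True
    show ?thesis
    proof (rule DERIV_nonpos_imp_nonincreasing[OF True])
      show "\<exists>y. (K has_real_derivative y) (at t) \<and> y \<le> 0" if "0 \<le> t" "t \<le> s" for t
      proof (intro exI conjI)
        show "\<psi> (t + h) - \<psi> (t - h) \<le> 0"
          unfolding \<psi>_def diff_le_0_iff_le
          using h that \<open>\<bar>s\<bar> \<le> L\<close> by (intro antimonoD[OF mono]) (auto simp: min_def abs_if)
      qed (rule derK)
    qed
  next
    case False
    then have "s \<le> 0" by simp
    show ?thesis
    proof (rule DERIV_nonneg_imp_nondecreasing[OF \<open>s \<le> 0\<close>])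
      show "\<exists>y. (K has_real_derivative y) (at t) \<and> 0 \<le> y" if "s \<le> t" "t \<le> 0" for t
      proof (intro exI conjI)
        show "0 \<le> \<psi> (t + h) - \<psi> (t - h)"
          unfolding \<psi>_def diff_ge_0_iff_ge
          using h that \<open>\<bar>s\<bar> \<le> L\<close> by (intro antimonoD[OF mono]) (auto simp: min_def abs_if)
      qed (rule derK)
    qed
  qed
  \<comment> \<open>\<open>\<psi>\<close> is \<open>2 L\<close>-periodic only between \<open>- 2 L\<close> and \<open>2 L\<close>, which contains all windows that occur.\<close>
  have shift: "\<Psi> w - \<Psi> (w - 2 * L) = \<Psi> w' - \<Psi> (w' - 2 * L)"
    if "w \<in> {0..2 * L}" "w' \<in> {0..2 * L}" for w w'
  proof (rule has_field_derivative_zero_constant[of "{0..2 * L}" "\<lambda>w. \<Psi> w - \<Psi> (w - 2 * L)", THEN exE])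
    show "((\<lambda>w. \<Psi> w - \<Psi> (w - 2 * L)) has_real_derivative 0) (at w within {0..2 * L})"
      if "w \<in> {0..2 * L}" for w
    proof -
      have "((\<lambda>w. \<Psi> w - \<Psi> (w - 2 * L)) has_real_derivative \<psi> w - \<psi> (w - 2 * L))
          (at w within {0..2 * L})"
        using DERIV_diff[OF der_shift[of 0] der_shift[of "- 2 * L"]] by simp
      moreover have "\<psi> w = \<psi> (w - 2 * L)"
        using that unfolding \<psi>_def by (intro arg_cong[where f = f]) (auto simp: min_def)
      ultimately show ?thesis by simp
    qed
  qed (use that in auto)
  define s where "s = x - midpoint u v"
  have s: "- 2 * L \<le> s - h" "s + h \<le> 2 * L"
    using assms by (auto simp: s_def h_def midpoint_def field_simps)
  have "K s \<le> K 0"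
  proof -
    consider "\<bar>s\<bar> \<le> L" | "L < s" | "s < - L" by linarith
    then show ?thesis
    proof cases
      case 2
      have "K s = K (s - 2 * L)"
        using shift[of "s + h" "s - h"] s h 2 by (simp add: K_def algebra_simps)
      then show ?thesis using near[of "s - 2 * L"] 2 s h by (auto simp: abs_if)
    next
      case 3
      have "K (s + 2 * L) = K s"
        using shift[of "s + 2 * L + h" "s + 2 * L - h"] s h 3 by (simp add: K_def algebra_simps)
      then show ?thesis using near[of "s + 2 * L"] 3 s h by (auto simp: abs_if)
    qed (rule near)
  qed
  then show ?thesis by (simp add: integral s_def)
qed

end

section \<open>Linear attraction below the break-even distance\<close>

locale linear_attraction = community_model L c Ep Eq "\<lambda>x. max 0 (f0 - a * x)" "\<lambda>_. g0"
  for L c Ep Eq f0 g0 a :: real +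
  fixes LC :: real
  assumes LC_pos: "0 < LC" and LC_le: "2 * LC \<le> L"
    and c_pos: "0 < c" and Ep_pos: "0 < Ep" and Eq_pos: "0 < Eq"
    and g0_pos: "0 < g0" and a_pos: "0 < a"
    and LC_less: "LC < f0 / a - c / (a * g0)"
begin

definition profit :: "real \<Rightarrow> real" where
  "profit r = g0 * max 0 (f0 - a * r) - c"

definition break_even :: real where
  "break_even = f0 / a - c / (a * g0)"

lemma LC_less_break_even: "LC < break_even"
  using LC_less by (simp add: break_even_def)

lemma profit_antimono: "r \<le> r' \<Longrightarrow> profit r' \<le> profit r"
  unfolding profit_def using g0_pos a_pos
  by (intro diff_right_mono mult_left_mono max.mono) auto

lemma break_even_times: "g0 * (f0 - a * break_even) = c"
  using g0_pos a_pos by (simp add: break_even_def field_simps)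

text \<open>
  Up to \<open>break_even\<close> the cutoff of the attraction at zero is inactive, since there the gross value
  \<open>g0 * (f0 - a * r)\<close> is still at least the cost \<open>c\<close>.
\<close>

lemma profit_break_even: "profit break_even = 0"
proof -
  have "0 < f0 - a * break_even"
    using break_even_times c_pos g0_pos by (metis zero_less_mult_pos)
  then show ?thesis using break_even_times by (simp add: profit_def)
qed

lemma profit_nonneg: "r \<le> break_even \<Longrightarrow> 0 \<le> profit r"
  using profit_antimono profit_break_even by metis

lemma profit_nonpos: "break_even \<le> r \<Longrightarrow> profit r \<le> 0"
  using profit_antimono profit_break_even by metis

lemma profit_LC: "0 < profit LC" "profit LC = g0 * (f0 - a * LC) - c"
proof -
  have "a * LC < a * break_even" using LC_less_break_even a_pos by simp
  then have *: "g0 * (f0 - a * break_even) < g0 * (f0 - a * LC)" using g0_pos by simp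
  moreover have "0 < f0 - a * LC"
    using * break_even_times c_pos g0_pos by (metis order_less_trans zero_less_mult_pos)
  ultimately show "profit LC = g0 * (f0 - a * LC) - c" "0 < profit LC"
    using break_even_times by (auto simp: profit_def)
qed

lemma profit_lipschitz: "\<bar>profit r - profit r'\<bar> \<le> g0 * a * \<bar>r - r'\<bar>"
proof -
  have "\<bar>profit r - profit r'\<bar> = g0 * \<bar>max 0 (f0 - a * r) - max 0 (f0 - a * r')\<bar>"
    using g0_pos by (simp add: profit_def abs_mult flip: right_diff_distrib)
  also have "\<dots> \<le> g0 * \<bar>a * (r - r')\<bar>"
    using g0_pos by (intro mult_left_mono) (auto simp: max_def abs_if algebra_simps)
  finally show ?thesis using a_pos by (simp add: abs_mult)
qed

lemma d_lipschitz: "\<bar>d x y - d x y'\<bar> \<le> \<bar>y - y'\<bar>"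
  unfolding d_def by (auto simp: min_def abs_if)

lemma d_le: "d x y \<le> \<bar>x - y\<bar>"
  by (simp add: d_def)

lemma d_eq: "\<bar>x - y\<bar> \<le> L \<Longrightarrow> d x y = \<bar>x - y\<bar>"
  by (simp add: d_def)

section \<open>Utilities in closed form\<close>

lemma topic_eq_midpoint:
  assumes "u \<in> {-L..<L}" and "v \<in> {-L..L}"
  shows "topic u v y = midpoint u v"
proof -
  have "continuous_on UNIV (\<lambda>x. max 0 (f0 - a * x))" by (intro continuous_intros)
  moreover have "antimono (\<lambda>x. max 0 (f0 - a * x))"
    using a_pos by (intro antimonoI max.mono) auto
  ultimately have *: "(LINT z:{u..<v}|lborel. p x z) \<le> (LINT z:{u..<v}|lborel. p (midpoint u v) z)"
    if "x \<in> R" for x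
    using p_integral_le_midpoint[of u v x] that assms
    by (cases "u \<le> v") (auto simp: R_def set_lebesgue_integral_def)
  have "midpoint u v \<in> R" using assms by (auto simp: R_def midpoint_def)
  then have "is_arg_max (\<lambda>x. q x y * (LINT z:{u..<v}|lborel. p x z)) (\<lambda>x. x \<in> R) (midpoint u v)"
    using * g0_pos by (auto simp: is_arg_max_def q_def not_less mult_left_mono)
  then show ?thesis by (simp add: topic_def)
qed

lemma pert_Ud_eq:
  assumes "u \<in> {-L..<L}" and "v \<in> {-L..L}"
  shows "pert_Ud u v u' v' y = Ep * Eq * max 0 (v' - u') * profit (d (midpoint u v) y)"
proof (cases "u' \<le> v'")
  case True
  then show ?thesis
    using topic_eq_midpoint[OF assms]
    by (simp add: pert_Ud_def set_integral_const q_def p_def profit_def)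
next
  case False
  then show ?thesis by (simp add: pert_Ud_def set_lebesgue_integral_def)
qed

lemma Ud1_eq:
  assumes "dl \<in> {-L..L}"
  shows "Ud1 LC LC dl sl y = Ep * Eq * max 0 (2 * LC + sl) * profit (d (dl / 2 - LC) y)"
  using assms LC_pos LC_le
  by (simp add: Ud1_def pert_Ud_eq midpoint_def diff_divide_distrib add.commute)

lemma Ud2_eq:
  assumes "dr \<in> {-L..<L}"
  shows "Ud2 LC LC dr sr y = Ep * Eq * max 0 (2 * LC - sr) * profit (d (LC + dr / 2) y)"
  using assms LC_pos LC_le
  by (simp add: Ud2_def pert_Ud_eq midpoint_def add_divide_distrib add.commute)

text \<open>
  With both consumer boundaries at \<open>e\<close>, the consumers of the two communities fill the intervals of
  radius \<open>LC + e / 2\<close> and \<open>LC - e / 2\<close> around their topics. The additional consumers of the left one all lie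
  within the break-even distance, so they only add to a producer's utility. Producers are
  indifferent to the distance to their topic, whence the two arbitrary agents \<open>y\<close> and \<open>y'\<close>.
\<close>

lemma Us_gap:
  assumes "0 \<le> e" and "e < L" and "LC + e / 2 \<le> break_even"
  shows "max 0 (Us2 LC LC e y) \<le> Us1 LC LC e y'"
proof -
  define \<psi> where "\<psi> = (\<lambda>w. profit \<bar>w\<bar>)"
  have cont: "continuous_on UNIV \<psi>"
    unfolding \<psi>_def profit_def by (intro continuous_intros)
  obtain \<Psi> where der: "\<And>w. (\<Psi> has_real_derivative \<psi> w) (at w)"
    using continuous_antiderivative[OF cont] by blast
  have eq: "pert_Us u v y = Ep * Eq * (\<Psi> ((v - u) / 2) - \<Psi> (- ((v - u) / 2)))"
    if "u \<in> {-L..<L}" "v \<in> {-L..L}" "u \<le> v" for u v y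
  proof -
    have "pert_Us u v y = Ep * Eq * (LINT z:{u..<v}|lborel. \<psi> (midpoint u v - z))"
      unfolding pert_Us_def topic_eq_midpoint[OF that(1,2)]
    proof (intro arg_cong[where f = "(*) (Ep * Eq)"] set_lebesgue_integral_cong allI impI)
      fix z assume "z \<in> {u..<v}"
      then have "\<bar>midpoint u v - z\<bar> \<le> L"
        using that by (auto simp: midpoint_def abs_if field_simps)
      then show "q (midpoint u v) y * p (midpoint u v) z - c = \<psi> (midpoint u v - z)"
        by (simp add: \<psi>_def profit_def q_def p_def d_eq)
    qed simp
    also have "(LINT z:{u..<v}|lborel. \<psi> (midpoint u v - z))
        = \<Psi> (midpoint u v - u) - \<Psi> (midpoint u v - v)"
      by (rule set_integral_reflected_antiderivative[OF cont der \<open>u \<le> v\<close>])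
    also have "midpoint u v - u = (v - u) / 2" by (simp add: midpoint_def field_simps)
    also have "midpoint u v - v = - ((v - u) / 2)" by (simp add: midpoint_def field_simps)
    finally show ?thesis .
  qed
  define h1 h2 where "h1 = LC + e / 2" and "h2 = max 0 (LC - e / 2)"
  have U1: "Us1 LC LC e y' = Ep * Eq * (\<Psi> h1 - \<Psi> (- h1))"
    unfolding Us1_def h1_def using assms LC_pos LC_le by (subst eq) (auto simp: algebra_simps add_divide_distrib)
  \<comment> \<open>For \<open>e > 2 LC\<close> the right community has no consumers; this is why \<open>h2\<close> is cut off at \<open>0\<close>.\<close>
  have U2: "Us2 LC LC e y = Ep * Eq * (\<Psi> h2 - \<Psi> (- h2))"
  proof (cases "e \<le> 2 * LC")
    case True
    then show ?thesis
      unfolding Us2_def h2_def using assms LC_pos LC_le by (subst eq) (auto simp: diff_divide_distrib)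
  next
    case False
    then show ?thesis
      by (simp add: Us2_def h2_def pert_Us_def set_lebesgue_integral_def)
  qed
  have mono: "\<Psi> w \<le> \<Psi> w'" if "- h1 \<le> w" "w \<le> w'" "w' \<le> h1" for w w'
  proof (rule DERIV_nonneg_imp_nondecreasing[OF that(2)])
    show "\<exists>y. (\<Psi> has_real_derivative y) (at t) \<and> 0 \<le> y" if "w \<le> t" "t \<le> w'" for t
      using that \<open>- h1 \<le> w\<close> \<open>w' \<le> h1\<close> assms(3) der[of t]
      by (intro exI[of _ "\<psi> t"]) (auto simp: \<psi>_def h1_def intro!: profit_nonneg)
  qed
  have h: "0 \<le> h2" "h2 \<le> h1" using assms LC_pos by (auto simp: h1_def h2_def)
  have "0 \<le> \<Psi> h1 - \<Psi> (- h1)" using mono[of "- h1" h1] h by simp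
  moreover have "\<Psi> h2 - \<Psi> (- h2) \<le> \<Psi> h1 - \<Psi> (- h1)"
    using mono[of "- h1" "- h2"] mono[of h2 h1] h by simp
  ultimately show ?thesis
    using Ep_pos Eq_pos by (simp add: U1 U2)
qed

text \<open>
  The boundary consumer sees content at distance \<open>LC + e / 2\<close> on the left and \<open>\<bar>LC - e / 2\<bar>\<close> on
  the right, from sets of producers of length at least \<open>2 LC + s\<close> and at most \<open>2 LC - s\<close>. With
  \<open>\<kappa> = profit LC\<close> and \<open>\<eta> = g0 a e / 2\<close> the two profits are bounded by \<open>\<kappa> - \<eta>\<close> from below and \<open>\<kappa> + \<eta>\<close> from above,
  and \<open>(2 LC + s) (\<kappa> - \<eta>) - (2 LC - s) (\<kappa> + \<eta>)\<close> is the claimed linear expression.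
\<close>

lemma boundary_consumer_drift:
  assumes "0 \<le> e" and "e < L" and "LC + e / 2 \<le> break_even"
    and "0 < s" and "s \<le> 2 * LC" and "s \<le> sl" and "s \<le> sr"
  shows "Ep * Eq * (2 * s * profit LC - 2 * LC * g0 * a * e)
    \<le> Ud1 LC LC e sl e - max 0 (Ud2 LC LC e sr e)"
proof -
  let ?\<kappa> = "profit LC" and ?\<eta> = "g0 * a * e / 2"
  have "?\<kappa> - ?\<eta> \<le> profit (LC + e / 2)"
    using profit_lipschitz[of LC "LC + e / 2"] assms by (simp add: abs_if split: if_splits)
  then have p1: "?\<kappa> - ?\<eta> \<le> profit (d (e / 2 - LC) e)"
    using profit_antimono[OF d_le[of "e / 2 - LC" e]] assms LC_pos by (simp add: abs_if split: if_splits)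
  have p1': "0 \<le> profit (d (e / 2 - LC) e)"
    using d_le[of "e / 2 - LC" e] assms LC_pos by (intro profit_nonneg) (simp add: abs_if split: if_splits)
  have d2: "d (LC + e / 2) e = \<bar>LC - e / 2\<bar>"
    using assms LC_pos LC_le by (subst d_eq) (auto simp: abs_if)
  have "profit (d (LC + e / 2) e) \<le> profit (LC - e / 2)"
    unfolding d2 by (intro profit_antimono) simp
  also have "\<dots> \<le> ?\<kappa> + ?\<eta>"
    using profit_lipschitz[of "LC - e / 2" LC] assms by (simp add: abs_if split: if_splits)
  finally have p2: "profit (d (LC + e / 2) e) \<le> ?\<kappa> + ?\<eta>" .
  have \<eta>: "0 \<le> ?\<eta>" using assms g0_pos a_pos by simp
  have "(2 * LC + s) * (?\<kappa> - ?\<eta>) \<le> (2 * LC + s) * profit (d (e / 2 - LC) e)"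
    using p1 assms LC_pos by (intro mult_left_mono) auto
  also have "\<dots> \<le> max 0 (2 * LC + sl) * profit (d (e / 2 - LC) e)"
    using p1' assms by (intro mult_right_mono) auto
  finally have lower: "(2 * LC + s) * (?\<kappa> - ?\<eta>) \<le> max 0 (2 * LC + sl) * profit (d (e / 2 - LC) e)" .
  have "max 0 (2 * LC - sr) * profit (d (LC + e / 2) e) \<le> max 0 (2 * LC - sr) * (?\<kappa> + ?\<eta>)"
    using p2 by (intro mult_left_mono) auto
  also have "\<dots> \<le> (2 * LC - s) * (?\<kappa> + ?\<eta>)"
    using assms \<eta> profit_LC by (intro mult_right_mono) auto
  finally have "max 0 (max 0 (2 * LC - sr) * profit (d (LC + e / 2) e)) \<le> (2 * LC - s) * (?\<kappa> + ?\<eta>)"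
    using assms \<eta> profit_LC by simp
  moreover have "(2 * LC + s) * (?\<kappa> - ?\<eta>) - (2 * LC - s) * (?\<kappa> + ?\<eta>)
      = 2 * s * ?\<kappa> - 2 * LC * g0 * a * e"
    by (simp add: field_simps)
  ultimately have "2 * s * ?\<kappa> - 2 * LC * g0 * a * e
      \<le> max 0 (2 * LC + sl) * profit (d (e / 2 - LC) e)
        - max 0 (max 0 (2 * LC - sr) * profit (d (LC + e / 2) e))"
    using lower by linarith
  then have "Ep * Eq * (2 * s * ?\<kappa> - 2 * LC * g0 * a * e)
      \<le> Ep * Eq * (max 0 (2 * LC + sl) * profit (d (e / 2 - LC) e)
        - max 0 (max 0 (2 * LC - sr) * profit (d (LC + e / 2) e)))"
    using Ep_pos Eq_pos by (intro mult_left_mono) auto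
  moreover have "max 0 (Ep * Eq * x) = Ep * Eq * max 0 x" for x
    using Ep_pos Eq_pos by (simp add: max_mult_distrib_left)
  ultimately show ?thesis
    using assms LC_pos LC_le by (simp add: Ud1_eq Ud2_eq right_diff_distrib mult.assoc)
qed

section \<open>Evolution from equal perturbations\<close>

lemma evolutionD:
  assumes "evolution LC LC dl dr sl sr" and "0 \<le> t"
  shows "dl t \<in> R" and "dr t \<in> R" and "sl t \<in> R" and "sr t \<in> R"
    and "(dl has_real_derivative Ud1 LC LC (dl t) (sl t) (dl t)
          - max 0 (Ud2 LC LC (dr t) (sr t) (dl t))) (at t within {0..})"
    and "(dr has_real_derivative max 0 (Ud1 LC LC (dl t) (sl t) (dr t))
          - Ud2 LC LC (dr t) (sr t) (dr t)) (at t within {0..})"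
    and "(sl has_real_derivative Us1 LC LC (dl t) (sl t)
          - max 0 (Us2 LC LC (dr t) (sl t))) (at t within {0..})"
    and "(sr has_real_derivative max 0 (Us1 LC LC (dl t) (sr t))
          - Us2 LC LC (dr t) (sr t)) (at t within {0..})"
proof -
  have cancel: "- LC + LC + x = x" "LC - LC + x = x" for x by simp_all
  have model: "in_model LC LC (dl t) (dr t) (sl t) (sr t)"
    using assms by (simp add: evolution_def)
  show "dl t \<in> R" "dr t \<in> R" "sl t \<in> R" "sr t \<in> R"
    using model unfolding in_model_def cancel by simp_all
  show "(dl has_real_derivative Ud1 LC LC (dl t) (sl t) (dl t)
          - max 0 (Ud2 LC LC (dr t) (sr t) (dl t))) (at t within {0..})"
    and "(dr has_real_derivative max 0 (Ud1 LC LC (dl t) (sl t) (dr t))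
          - Ud2 LC LC (dr t) (sr t) (dr t)) (at t within {0..})"
    and "(sl has_real_derivative Us1 LC LC (dl t) (sl t)
          - max 0 (Us2 LC LC (dr t) (sl t))) (at t within {0..})"
    and "(sr has_real_derivative max 0 (Us1 LC LC (dl t) (sr t))
          - Us2 LC LC (dr t) (sr t)) (at t within {0..})"
    using assms(1)[unfolded evolution_def cancel, rule_format, OF assms(2)] by simp_all
qed

lemma max_0_lipschitz: "\<bar>max 0 x - max 0 y\<bar> \<le> \<bar>x - y\<bar>" for x y :: real
  by (auto simp: max_def)

lemma profit_at_lipschitz: "\<bar>profit (d x y) - profit (d x y')\<bar> \<le> g0 * a * \<bar>y - y'\<bar>"
proof -
  have "\<bar>profit (d x y) - profit (d x y')\<bar> \<le> g0 * a * \<bar>d x y - d x y'\<bar>"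
    by (rule profit_lipschitz)
  also have "\<dots> \<le> g0 * a * \<bar>y - y'\<bar>"
    using g0_pos a_pos by (intro mult_left_mono d_lipschitz) auto
  finally show ?thesis .
qed

text \<open>
  In a community other than its own a boundary consumer may have negative utility, and only the
  positive part enters the evolution; hence the estimate is for positive parts.
\<close>

lemma max_0_Ud_lipschitz:
  assumes "dl \<in> R" and "dr \<in> R" and "sl \<in> R" and "sr \<in> R"
  shows "\<bar>max 0 (Ud1 LC LC dl sl y) - max 0 (Ud1 LC LC dl sl y')\<bar>
      \<le> Ep * Eq * (2 * L) * g0 * a * \<bar>y - y'\<bar>"
    and "\<bar>max 0 (Ud2 LC LC dr sr y) - max 0 (Ud2 LC LC dr sr y')\<bar>
      \<le> Ep * Eq * (2 * L) * g0 * a * \<bar>y - y'\<bar>"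
proof -
  have *: "\<bar>max 0 (Ep * Eq * max 0 w * profit (d x y)) - max 0 (Ep * Eq * max 0 w * profit (d x y'))\<bar>
      \<le> Ep * Eq * (2 * L) * g0 * a * \<bar>y - y'\<bar>" if "w \<le> 2 * L" for w x
  proof -
    have "\<bar>max 0 (Ep * Eq * max 0 w * profit (d x y)) - max 0 (Ep * Eq * max 0 w * profit (d x y'))\<bar>
        \<le> \<bar>Ep * Eq * max 0 w * profit (d x y) - Ep * Eq * max 0 w * profit (d x y')\<bar>"
      by (rule max_0_lipschitz)
    also have "\<dots> = Ep * Eq * max 0 w * \<bar>profit (d x y) - profit (d x y')\<bar>"
      using Ep_pos Eq_pos by (simp add: abs_mult flip: right_diff_distrib)
    also have "\<dots> \<le> Ep * Eq * max 0 w * (g0 * a * \<bar>y - y'\<bar>)"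
      using Ep_pos Eq_pos by (intro mult_left_mono profit_at_lipschitz) auto
    also have "\<dots> \<le> Ep * Eq * (2 * L) * (g0 * a * \<bar>y - y'\<bar>)"
      using Ep_pos Eq_pos g0_pos a_pos LC_pos LC_le that
      by (intro mult_right_mono mult_left_mono) auto
    finally show ?thesis by (simp add: mult.assoc)
  qed
  show "\<bar>max 0 (Ud1 LC LC dl sl y) - max 0 (Ud1 LC LC dl sl y')\<bar>
      \<le> Ep * Eq * (2 * L) * g0 * a * \<bar>y - y'\<bar>"
    using assms LC_le *[of "2 * LC + sl" "dl / 2 - LC"] by (simp add: R_def Ud1_eq)
  show "\<bar>max 0 (Ud2 LC LC dr sr y) - max 0 (Ud2 LC LC dr sr y')\<bar>
      \<le> Ep * Eq * (2 * L) * g0 * a * \<bar>y - y'\<bar>"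
    using assms LC_le *[of "2 * LC - sr" "LC + dr / 2"] by (simp add: R_def Ud2_eq)
qed

lemma Ud1_nonneg:
  assumes "dl \<in> R" and "0 \<le> dl" and "LC + dl / 2 \<le> break_even"
  shows "0 \<le> Ud1 LC LC dl sl dl"
proof -
  have "d (dl / 2 - LC) dl \<le> break_even"
    using d_le[of "dl / 2 - LC" dl] assms LC_pos by linarith
  then show ?thesis
    using assms Ep_pos Eq_pos by (simp add: Ud1_eq R_def profit_nonneg)
qed

lemma Ud2_nonneg:
  assumes "dr \<in> R" and "0 \<le> dr" and "dr / 2 - LC \<le> break_even"
  shows "0 \<le> Ud2 LC LC dr sr dr"
proof -
  have "d (LC + dr / 2) dr \<le> break_even"
    using d_le[of "LC + dr / 2" dr] assms LC_less_break_even by linarith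
  then show ?thesis
    using assms Ep_pos Eq_pos by (simp add: Ud2_eq R_def profit_nonneg)
qed

lemma boundary_consumer_le:
  assumes evo: "evolution LC LC dl dr sl sr" and "LC + dl 0 / 2 \<le> break_even" and "0 \<le> t"
  shows "LC + dl t / 2 \<le> break_even"
proof -
  have "dl t \<le> 2 * (break_even - LC)"
  proof (rule upper_barrier[OF evolutionD(5)[OF evo]])
    fix t :: real assume t: "0 < t" "2 * (break_even - LC) < dl t"
    have dl: "dl t \<in> R" using evolutionD(1)[OF evo] t by simp
    have "d (dl t / 2 - LC) (dl t) = LC + dl t / 2"
      using dl t LC_less_break_even LC_pos LC_le by (subst d_eq) (auto simp: R_def)
    then have "profit (d (dl t / 2 - LC) (dl t)) \<le> 0"
      using t by (intro profit_nonpos) simp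
    then have "Ud1 LC LC (dl t) (sl t) (dl t) \<le> 0"
      using dl Ep_pos Eq_pos by (simp add: Ud1_eq R_def mult_nonneg_nonpos)
    then show "Ud1 LC LC (dl t) (sl t) (dl t) - max 0 (Ud2 LC LC (dr t) (sr t) (dl t)) \<le> 0"
      by simp
  qed (use assms in auto)
  then show ?thesis by simp
qed

text \<open>
  The velocity of \<open>dl\<close> contains \<open>Ud1\<close> without its positive part, and that of \<open>dr\<close> contains \<open>Ud2\<close>
  without it. As long as these two are nonnegative, both boundaries move with the velocity
  \<open>max 0 Ud1 - max 0 Ud2\<close>, taken at \<open>dl\<close> and at \<open>dr\<close> respectively, and Gronwall's inequality
  keeps them together.
\<close>

lemma boundaries_coincide:
  assumes evo: "evolution LC LC dl dr sl sr" and "dl 0 = dr 0"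
    and dl: "LC + dl 0 / 2 \<le> break_even"
    and region: "\<And>t. 0 < t \<Longrightarrow> t < T \<Longrightarrow> 0 \<le> dl t \<and> 0 \<le> dr t \<and> dr t / 2 - LC \<le> break_even"
    and "0 \<le> t" and "t \<le> T"
  shows "dr t = dl t"
proof -
  have "dl t - dr t = 0"
  proof (rule gronwall_zero[where w = "\<lambda>t. dl t - dr t" and T = T
        and D = "\<lambda>t. (Ud1 LC LC (dl t) (sl t) (dl t) - max 0 (Ud2 LC LC (dr t) (sr t) (dl t)))
          - (max 0 (Ud1 LC LC (dl t) (sl t) (dr t)) - Ud2 LC LC (dr t) (sr t) (dr t))"
        and M = "2 * (Ep * Eq * (2 * L) * g0 * a)"])
    show "((\<lambda>t. dl t - dr t) has_real_derivative
        (Ud1 LC LC (dl t) (sl t) (dl t) - max 0 (Ud2 LC LC (dr t) (sr t) (dl t)))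
        - (max 0 (Ud1 LC LC (dl t) (sl t) (dr t)) - Ud2 LC LC (dr t) (sr t) (dr t)))
        (at t within {0..})" if "0 \<le> t" for t
      by (rule DERIV_diff[OF evolutionD(5,6)[OF evo that]])
    fix t assume t: "0 < t" "t < T"
    note in_R = evolutionD(1-4)[OF evo less_imp_le[OF t(1)]]
    have "0 \<le> Ud1 LC LC (dl t) (sl t) (dl t)"
      using region[OF t] boundary_consumer_le[OF evo dl] t in_R by (intro Ud1_nonneg) auto
    moreover have "0 \<le> Ud2 LC LC (dr t) (sr t) (dr t)"
      using region[OF t] in_R by (intro Ud2_nonneg) auto
    ultimately have "(Ud1 LC LC (dl t) (sl t) (dl t) - max 0 (Ud2 LC LC (dr t) (sr t) (dl t)))
        - (max 0 (Ud1 LC LC (dl t) (sl t) (dr t)) - Ud2 LC LC (dr t) (sr t) (dr t))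
        = (max 0 (Ud1 LC LC (dl t) (sl t) (dl t)) - max 0 (Ud1 LC LC (dl t) (sl t) (dr t)))
        - (max 0 (Ud2 LC LC (dr t) (sr t) (dl t)) - max 0 (Ud2 LC LC (dr t) (sr t) (dr t)))"
      by simp
    also have "\<bar>\<dots>\<bar> \<le> Ep * Eq * (2 * L) * g0 * a * \<bar>dl t - dr t\<bar>
        + Ep * Eq * (2 * L) * g0 * a * \<bar>dl t - dr t\<bar>"
      by (intro order_trans[OF abs_triangle_ineq4] add_mono max_0_Ud_lipschitz[OF in_R])
    finally show "\<bar>(Ud1 LC LC (dl t) (sl t) (dl t) - max 0 (Ud2 LC LC (dr t) (sr t) (dl t)))
        - (max 0 (Ud1 LC LC (dl t) (sl t) (dr t)) - Ud2 LC LC (dr t) (sr t) (dr t))\<bar>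
        \<le> 2 * (Ep * Eq * (2 * L) * g0 * a) * \<bar>dl t - dr t\<bar>"
      by (simp add: algebra_simps)
  qed (use assms in auto)
  then show ?thesis by simp
qed

lemma producers_nondecreasing:
  assumes evo: "evolution LC LC dl dr sl sr"
    and region: "\<And>t. 0 < t \<Longrightarrow> t < T \<Longrightarrow> 0 \<le> dl t \<and> dr t = dl t \<and> LC + dl t / 2 \<le> break_even"
    and "0 \<le> T"
  shows "sl 0 \<le> sl T" and "sr 0 \<le> sr T"
proof -
  have gap: "max 0 (Us2 LC LC (dr t) y) \<le> Us1 LC LC (dl t) y'" if "0 < t" "t < T" for t y y'
    using region[OF that] evolutionD(1)[OF evo, of t] that Us_gap[of "dl t" y y'] by (simp add: R_def)
  show "sl 0 \<le> sl T"
    by (rule nondecreasing_on_trajectory[OF evolutionD(7)[OF evo]])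
      (use gap \<open>0 \<le> T\<close> in auto)
  show "sr 0 \<le> sr T"
  proof (rule nondecreasing_on_trajectory[OF evolutionD(8)[OF evo]])
    show "0 \<le> max 0 (Us1 LC LC (dl t) (sr t)) - Us2 LC LC (dr t) (sr t)" if "0 < t" "t < T" for t
      using gap[OF that, of "sr t" "sr t"] by linarith
  qed (use \<open>0 \<le> T\<close> in auto)
qed

text \<open>
  Continuation in the open region \<open>0 < dl\<close>, \<open>0 < dr < 2 (break_even + LC)\<close>. Up to a first exit time
  \<open>T\<close> the boundaries coincide, so \<open>dr T = dl T \<le> 2 (break_even - LC)\<close> and the exit is at \<open>dl T = 0\<close>.
  But the producer boundaries are still at least \<open>e\<close> there, so \<open>dl\<close> has a positive derivative at
  \<open>T\<close> and was negative just before.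
\<close>

lemma symmetric_evolution:
  assumes evo: "evolution LC LC dl dr sl sr"
    and init: "dl 0 = e" "dr 0 = e" "sl 0 = e" "sr 0 = e"
    and e: "0 < e" "LC + e / 2 \<le> break_even" "e \<le> 2 * LC" and "0 \<le> t"
  shows "0 < dl t" and "dr t = dl t" and "LC + dl t / 2 \<le> break_even"
    and "e \<le> sl t" and "e \<le> sr t"
proof -
  have dl_le: "LC + dl t / 2 \<le> break_even" if "0 \<le> t" for t
    using boundary_consumer_le[OF evo _ that] init e by simp
  let ?b = "2 * (break_even + LC)"
  define m where "m = (\<lambda>t. min (min (dl t) (dr t)) (?b - dr t))"
  have coincide: "dr T = dl T" if "0 \<le> T" and pos: "\<And>s. 0 \<le> s \<Longrightarrow> s < T \<Longrightarrow> 0 < m s" for T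
  proof (rule boundaries_coincide[OF evo])
    show "0 \<le> dl s \<and> 0 \<le> dr s \<and> dr s / 2 - LC \<le> break_even" if "0 < s" "s < T" for s
      using pos[of s] that by (simp add: m_def field_simps)
  qed (use init e \<open>0 \<le> T\<close> in simp_all)
  have grow: "sl 0 \<le> sl T" "sr 0 \<le> sr T" if "0 \<le> T" and pos: "\<And>s. 0 \<le> s \<Longrightarrow> s < T \<Longrightarrow> 0 < m s" for T
  proof -
    have region: "0 \<le> dl s \<and> dr s = dl s \<and> LC + dl s / 2 \<le> break_even" if "0 < s" "s < T" for s
    proof (intro conjI)
      show "0 \<le> dl s" using pos[of s] that by (simp add: m_def)
      show "dr s = dl s" by (rule coincide) (use pos that in auto)
      show "LC + dl s / 2 \<le> break_even" using dl_le that by simp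
    qed
    show "sl 0 \<le> sl T" by (rule producers_nondecreasing(1)[OF evo region \<open>0 \<le> T\<close>])
    show "sr 0 \<le> sr T" by (rule producers_nondecreasing(2)[OF evo region \<open>0 \<le> T\<close>])
  qed
  have m_pos: "0 < m t" if "0 \<le> t" for t
  proof (rule positive_by_continuation[OF _ _ _ that])
    show "continuous_on {0..} m"
      unfolding m_def
      by (intro continuous_intros continuous_on_trajectory[OF evolutionD(5)[OF evo]]
          continuous_on_trajectory[OF evolutionD(6)[OF evo]])
    show "0 < m 0" using init e LC_pos by (simp add: m_def)
    fix T :: real assume T: "0 < T" and pos: "\<And>s. 0 \<le> s \<Longrightarrow> s < T \<Longrightarrow> 0 < m s"
    show "m T \<noteq> 0"
    proof
      assume "m T = 0"
      have eq: "dr T = dl T" using coincide[of T] T pos by simp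
      have zero: "dl T = 0"
        using \<open>m T = 0\<close> eq dl_le[of T] T LC_pos by (simp add: m_def min_def split: if_splits)
      have "0 < Ep * Eq * (2 * e * profit LC)"
        using Ep_pos Eq_pos e profit_LC by simp
      also have "\<dots> \<le> Ud1 LC LC (dl T) (sl T) (dl T) - max 0 (Ud2 LC LC (dr T) (sr T) (dl T))"
        using boundary_consumer_drift[of 0 e "sl T" "sr T"] grow[of T] T pos init e LC_pos LC_le
          LC_less_break_even by (simp add: zero eq)
      finally obtain \<eta> where \<eta>: "0 < \<eta>" "\<And>h. 0 < h \<Longrightarrow> T - h \<in> {0..} \<Longrightarrow> h < \<eta> \<Longrightarrow> dl (T - h) < dl T"
        using has_real_derivative_pos_inc_left[OF evolutionD(5)[OF evo]] T by (meson less_imp_le)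
      define h where "h = min (\<eta> / 2) (T / 2)"
      have h: "0 < h" "h < \<eta>" "h < T" using \<eta>(1) T by (auto simp: h_def)
      have "dl (T - h) < 0" using \<eta>(2)[of h] h zero by simp
      then show False using pos[of "T - h"] h by (simp add: m_def)
    qed
  qed
  show "0 < dl t" using m_pos[OF \<open>0 \<le> t\<close>] by (simp add: m_def)
  show "dr t = dl t" using coincide[OF \<open>0 \<le> t\<close>] m_pos by simp
  show "LC + dl t / 2 \<le> break_even" by (rule dl_le[OF \<open>0 \<le> t\<close>])
  show "e \<le> sl t" "e \<le> sr t" using grow[OF \<open>0 \<le> t\<close>] m_pos init by auto
qed

section \<open>Failure of stability and of neutral stability\<close>

text \<open>
  The displacement \<open>\<epsilon>\<close> is the one at which the restoring term \<open>2 LC g0 a \<epsilon>\<close> of the drift uses up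
  half of the attraction \<open>2 e profit LC\<close> exerted by the displaced producers. While \<open>dl < \<epsilon>\<close>, the other half
  leaves a drift of at least \<open>\<eta> > 0\<close>. After a time \<open>\<epsilon> / \<eta>\<close> below \<open>\<epsilon>\<close>, \<open>dl\<close> would have grown beyond \<open>\<epsilon>\<close>.
\<close>

lemma boundary_consumers_not_tendsto_0:
  assumes evo: "evolution LC LC dl dr sl sr"
    and init: "dl 0 = e" "dr 0 = e" "sl 0 = e" "sr 0 = e"
    and e: "0 < e" "LC + e / 2 \<le> break_even" "e \<le> 2 * LC"
  shows "\<not> (dl \<longlongrightarrow> 0) at_top"
proof
  assume lim: "(dl \<longlongrightarrow> 0) at_top"
  note sym = symmetric_evolution[OF evo init e]
  define \<eta> where "\<eta> = Ep * Eq * (e * profit LC)"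
  define \<epsilon> where "\<epsilon> = e * profit LC / (2 * LC * g0 * a)"
  have \<eta>: "0 < \<eta>" using Ep_pos Eq_pos e profit_LC by (simp add: \<eta>_def)
  have \<epsilon>: "0 < \<epsilon>" using g0_pos a_pos LC_pos e profit_LC by (simp add: \<epsilon>_def)
  obtain t0 where t0: "0 \<le> t0" "\<And>t. t0 \<le> t \<Longrightarrow> dl t < \<epsilon>"
    using order_tendstoD(2)[OF lim \<epsilon>] unfolding eventually_at_top_linorder
    by (metis max.bounded_iff max.cobounded1 max.cobounded2)
  define D where "D = (\<lambda>t. Ud1 LC LC (dl t) (sl t) (dl t) - max 0 (Ud2 LC LC (dr t) (sr t) (dl t)))"
  have drift: "\<eta> \<le> D t" if "t0 \<le> t" for t
  proof -
    have t: "0 \<le> t" using t0 that by simp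
    have "2 * LC * g0 * a * dl t \<le> 2 * LC * g0 * a * \<epsilon>"
      using t0(2)[OF that] g0_pos a_pos LC_pos by (intro mult_left_mono) auto
    also have "\<dots> = e * profit LC" using g0_pos a_pos LC_pos by (simp add: \<epsilon>_def)
    finally have "\<eta> \<le> Ep * Eq * (2 * e * profit LC - 2 * LC * g0 * a * dl t)"
      unfolding \<eta>_def using Ep_pos Eq_pos by (intro mult_left_mono) auto
    also have "\<dots> \<le> D t"
      unfolding D_def sym(2)[OF t]
      using sym[OF t] e evolutionD(1)[OF evo t]
      by (intro boundary_consumer_drift) (auto simp: R_def)
    finally show ?thesis .
  qed
  define t where "t = t0 + \<epsilon> / \<eta>"
  have t: "t0 \<le> t" using \<epsilon> \<eta> by (simp add: t_def)
  have "dl t0 - \<eta> * t0 \<le> dl t - \<eta> * t"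
  proof (rule nondecreasing_on_trajectory[where x = "\<lambda>t. dl t - \<eta> * t" and D = "\<lambda>t. D t - \<eta>"
        and a = t0 and b = t])
    show "((\<lambda>t. dl t - \<eta> * t) has_real_derivative D t - \<eta>) (at t within {0..})" if "0 \<le> t" for t
      unfolding D_def by (rule DERIV_diff[OF evolutionD(5)[OF evo that]]) (auto intro!: derivative_eq_intros)
  qed (use drift t0 t in auto)
  moreover have "\<eta> * t = \<eta> * t0 + \<epsilon>" using \<eta> by (simp add: t_def field_simps)
  ultimately have "\<epsilon> < dl t" using sym(1)[OF t0(1)] by simp
  then show False using t0(2)[OF t] by simp
qed

text \<open>
  Four equal perturbations are admissible for every \<open>\<delta>\<close>, so it suffices to refute \<open>Phi\<close> on the
  evolutions that start from them.
\<close>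

lemma not_for_small_perturbations:
  assumes "\<And>\<delta> e dl dr sl sr. \<lbrakk>evolution LC LC dl dr sl sr; dl 0 = e; dr 0 = e; sl 0 = e; sr 0 = e;
      0 < e; LC + e / 2 \<le> break_even; e \<le> 2 * LC\<rbrakk> \<Longrightarrow> \<not> Phi \<delta> dl dr sl sr"
  shows "\<not> for_small_perturbations LC LC Phi"
proof
  assume "for_small_perturbations LC LC Phi"
  then obtain \<delta> where "0 < \<delta>" and \<delta>: "\<And>e. e \<in> {0<..\<delta>} \<Longrightarrow>
      (\<exists>dl dr sl sr. evolution LC LC dl dr sl sr \<and> dl 0 = e \<and> dr 0 = e \<and> sl 0 = e \<and> sr 0 = e) \<and>
      (\<forall>dl dr sl sr. evolution LC LC dl dr sl sr \<and> dl 0 = e \<and> dr 0 = e \<and> sl 0 = e \<and> sr 0 = e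
        \<longrightarrow> Phi \<delta> dl dr sl sr)"
    unfolding for_small_perturbations_def initial_perturbation_def by fastforce
  define e where "e = min \<delta> (min (2 * (break_even - LC)) (2 * LC))"
  have "0 < e" "e \<le> \<delta>" "e \<le> 2 * (break_even - LC)" "e \<le> 2 * LC"
    unfolding e_def using \<open>0 < \<delta>\<close> LC_pos LC_less_break_even by auto
  then have e: "0 < e" "e \<le> \<delta>" "LC + e / 2 \<le> break_even" "e \<le> 2 * LC" by auto
  obtain dl dr sl sr where "evolution LC LC dl dr sl sr" "dl 0 = e" "dr 0 = e" "sl 0 = e" "sr 0 = e"
    and "Phi \<delta> dl dr sl sr"
    using \<delta>[of e] e by auto
  then show False using assms e by blast
qed

lemma producers_not_tendsto_0:
  assumes "evolution LC LC dl dr sl sr" and "dl 0 = e" "dr 0 = e" "sl 0 = e" "sr 0 = e"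
    and "0 < e" "LC + e / 2 \<le> break_even" "e \<le> 2 * LC"
  shows "\<not> (sl \<longlongrightarrow> 0) at_top"
proof
  assume "(sl \<longlongrightarrow> 0) at_top"
  moreover have "eventually (\<lambda>t. e \<le> sl t) at_top"
    unfolding eventually_at_top_linorder using symmetric_evolution(4)[OF assms] by blast
  ultimately have "e \<le> 0" by (intro tendsto_lowerbound) auto
  then show False using \<open>0 < e\<close> by simp
qed

lemma not_stable: "\<not> stable LC LC"
  unfolding stable_def using producers_not_tendsto_0 by (intro not_for_small_perturbations) blast

lemma not_neutral_stable: "\<not> neutral_stable LC LC"
  unfolding neutral_stable_def de_Morgan_disj
  using producers_not_tendsto_0 boundary_consumers_not_tendsto_0
  by (intro conjI not_for_small_perturbations) blast+

end

theorem proposition5p1: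
  fixes L c Ep Eq f0 g0 a LC ld m1 :: real and f g :: "real \<Rightarrow> real" and N :: nat
  assumes "L > 0" and "c > 0" and "0 < Ep" and "Ep \<le> 1" and "Eq > 0"
    and "0 < f0" and "f0 \<le> 1" and "0 < g0" and "g0 \<le> 1" and "a > 0" and "f0 * g0 > c"
    and "f = (\<lambda>x. max 0 (f0 - a * x))" and "g = (\<lambda>x. g0)"
    and "N \<ge> 2" and "LC = L / real N" and "0 < ld" and "ld \<le> LC"
    and "\<forall>k<N. community_model.center m1 LC k \<in> community_model.R L"
    and "community_model.nash_equilibrium L c Ep Eq f g
           (community_model.family L N m1 LC ld)
           (community_model.family_alpha Ep)
           (community_model.family_beta L Ep Eq f g)"
    and "ld = LC"
    and "LC < f0 / a - c / (a * g0)"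
  shows "\<not> community_model.stable L c Ep Eq f g LC ld \<and>
         \<not> community_model.neutral_stable L c Ep Eq f g LC ld"
proof -
  have "L = LC * real N" and "0 < LC" using assms by simp_all
  moreover have "LC * 2 \<le> LC * real N"
    using \<open>0 < LC\<close> \<open>N \<ge> 2\<close> by (intro mult_left_mono) auto
  ultimately have "2 * LC \<le> L" by linarith
  then interpret linear_attraction L c Ep Eq f0 g0 a LC
    using assms by unfold_locales auto
  show ?thesis
    using not_stable not_neutral_stable assms by simp
qed

end
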